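(* Let $\tau\in\mathbb{R}\setminus\{0,-1,-2,\dots\}$ and let $\hat P=P\Delta^{(\tau)}$ be the product of the Pascal matrix and the fractional difference matrix of order $\tau$. For every $1\le p<\infty$ the space $\ell_p(\hat P)$ is of non-absolute type.
   Context: $\omega$ denotes the space of all (real or complex) sequences $x=(x_k)_{k\ge 0}$. For real $a$ and integer $m\ge 0$, the expression $\frac{\Gamma(a+1)}{m!\,\Gamma(a-m+1)}$ is understood as the generalized binomial coefficient $\frac{a(a-1)\cdots(a-m+1)}{m!}$ (equal to $1$ for $m=0$). The matrix $\hat P=(\hat p_{nk})_{n,k\ge0}=P\Delta^{(\tau)}$ is lower triangular with $$\hat p_{nk}=\sum_{i=k}^{n}(-1)^{i-k}\binom{n}{n-i}\frac{\Gamma(\tau+1)}{(i-k)!\,\Gamma(\tau-i+k+1)}\quad(0\le k\le n),\qquad \hat p_{nk}=0\quad (k>n).$$ It is the product of the Pascal matrix $P=(\binom{n}{n-k})_{0\le k\le n}$ and the lower triangular matrix $\Delta^{(\tau)}$ with entries $(-1)^{n-k}\frac{\Gamma(\tau+1)}{(n-k)!\,\Gamma(\tau-n+k+1)}$ for $0\le k\le n$. For $x\in\omega$, $(\hat P x)_n=\sum_{k=0}^n\hat p_{nk}x_k$. For $1\le p<\infty$, $\ell_p(\hat P)=\{x\in\omega:\hat P x\in\ell_p\}$ with $\|x\|_{\ell_p(\hat P)}=\|\hat P x\|_{\ell_p}=(\sum_k|(\hat P x)_k|^p)^{1/p}$. For $x=(x_k)$ write $|x|=(|x_k|)$. The space $\ell_p(\hat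 P)$ is of non-absolute type if there is at least one sequence $x\in\ell_p(\hat P)$ with $\|x\|_{\ell_p(\hat P)}\ne\||x|\|_{\ell_p(\hat P)}$, where the right-hand side is taken to be $\infty$ if $|x|\notin\ell_p(\hat P)$. *)

theory Defs
  imports Complex_Main "HOL-Library.Nonpos_Ints" "HOL-Library.Extended_Nonnegative_Real"
begin

text \<open>
  Infinite matrices are functions of the row and the column index, both starting at 0.
\<close>

definition pascal :: "nat \<Rightarrow> nat \<Rightarrow> real" where
  "pascal n k = (if k \<le> n then of_nat (n choose (n - k)) else 0)"

text \<open>
  The quotient \<open>\<Gamma>(\<tau>+1) / (m! \<Gamma>(\<tau>-m+1))\<close> is read as the generalised binomial coefficient
  \<open>\<tau>(\<tau>-1)\<dots>(\<tau>-m+1) / m!\<close>, which is also meaningful at the poles of \<open>\<Gamma>\<close>.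
\<close>

definition frac_diff :: "real \<Rightarrow> nat \<Rightarrow> nat \<Rightarrow> real" where
  "frac_diff \<tau> n k = (if k \<le> n then (-1) ^ (n - k) * (\<tau> gchoose (n - k)) else 0)"

text \<open>
  The matrix product; row \<open>n\<close> of the Pascal matrix vanishes beyond column \<open>n\<close>.
\<close>

definition Phat :: "real \<Rightarrow> nat \<Rightarrow> nat \<Rightarrow> real" where
  "Phat \<tau> n k = (\<Sum>i\<le>n. pascal n i * frac_diff \<tau> i k)"

lemma Phat_entry:
  "Phat \<tau> n k = (\<Sum>i=k..n. (-1) ^ (i - k) * of_nat (n choose (n - i)) * (\<tau> gchoose (i - k)))"
proof -
  have "Phat \<tau> n k = (\<Sum>i=k..n. pascal n i * frac_diff \<tau> i k)"
    unfolding Phat_def by (rule sum.mono_neutral_right) (auto simp: frac_diff_def)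
  also have "\<dots> = (\<Sum>i=k..n. (-1) ^ (i - k) * of_nat (n choose (n - i)) * (\<tau> gchoose (i - k)))"
    by (rule sum.cong) (auto simp: pascal_def frac_diff_def)
  finally show ?thesis .
qed

lemma Phat_upper: "k > n \<Longrightarrow> Phat \<tau> n k = 0"
  by (simp add: Phat_entry)

definition Phat_app :: "real \<Rightarrow> (nat \<Rightarrow> 'a::real_normed_field) \<Rightarrow> nat \<Rightarrow> 'a" where
  "Phat_app \<tau> x n = (\<Sum>k\<le>n. of_real (Phat \<tau> n k) * x k)"

definition lp :: "real \<Rightarrow> (nat \<Rightarrow> 'a::real_normed_field) set" where
  "lp p = {x. summable (\<lambda>k. norm (x k) powr p)}"

definition lp_norm :: "real \<Rightarrow> (nat \<Rightarrow> 'a::real_normed_field) \<Rightarrow> real" where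
  "lp_norm p x = (\<Sum>k. norm (x k) powr p) powr (1 / p)"

definition lp_Phat :: "real \<Rightarrow> real \<Rightarrow> (nat \<Rightarrow> 'a::real_normed_field) set" where
  "lp_Phat p \<tau> = {x. Phat_app \<tau> x \<in> lp p}"

definition lp_Phat_norm :: "real \<Rightarrow> real \<Rightarrow> (nat \<Rightarrow> 'a::real_normed_field) \<Rightarrow> real" where
  "lp_Phat_norm p \<tau> x = lp_norm p (Phat_app \<tau> x)"

definition abs_seq :: "(nat \<Rightarrow> 'a::real_normed_field) \<Rightarrow> nat \<Rightarrow> 'a" where
  "abs_seq x k = of_real (norm (x k))"

text \<open>
  \<open>N\<close> is only meaningful on \<open>X\<close>; the norm of \<open>|x|\<close> counts as infinite when \<open>|x|\<close> is outside \<open>X\<close>.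
\<close>

definition non_absolute_type ::
  "(nat \<Rightarrow> 'a::real_normed_field) set \<Rightarrow> ((nat \<Rightarrow> 'a) \<Rightarrow> real) \<Rightarrow> bool" where
  "non_absolute_type X N \<longleftrightarrow>
     (\<exists>x\<in>X. ennreal (N x) \<noteq> (if abs_seq x \<in> X then ennreal (N (abs_seq x)) else \<infinity>))"

end

theory Submission imports Defs begin

text \<open>
  The matrix is lower unitriangular, hence \<open>e\<^sub>j\<close> is the image of some \<open>x\<close>, and
  \<open>x = (0, \<dots>, 0, 1, -(j + 1 - \<tau>), \<dots>)\<close> with the 1 at position \<open>j\<close>. For \<open>j + 1 > \<tau>\<close>
  the coordinate \<open>x\<^sub>j\<^sub>+\<^sub>1\<close> is negative, so passing to \<open>|x|\<close> keeps the image at \<open>1\<close> in position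
  \<open>j\<close> but turns the \<open>0\<close> in position \<open>j + 1\<close> into \<open>2(j + 1 - \<tau>) > 0\<close>. Thus \<open>\<parallel>x\<parallel> = 1\<close>, while the
  norm of \<open>|x|\<close> exceeds 1.
\<close>

lemma Phat_diag: "Phat \<tau> n n = 1"
  by (simp add: Phat_entry)

text \<open>Only \<open>i = n\<close> and \<open>i = Suc n\<close> contribute: the first gives the
  Pascal entry \<open>Suc n\<close>, the second gives -\<tau>.\<close>

lemma Phat_subdiag: "Phat \<tau> (Suc n) n = of_nat (Suc n) - \<tau>"
  by (simp add: Phat_entry)

text \<open>Row \<open>n\<close> of the system \<open>A x = y\<close> solved for its last unknown;
  no division occurs because the diagonal is meant to be 1.\<close>

fun forward_subst :: "(nat \<Rightarrow> nat \<Rightarrow> 'a::comm_ring_1) \<Rightarrow> (nat \<Rightarrow> 'a) \<Rightarrow> nat \<Rightarrow> 'a" where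
  "forward_subst A y n = y n - (\<Sum>k<n. A n k * forward_subst A y k)"

declare forward_subst.simps [simp del]

lemma unitriangular_solve:
  fixes A :: "nat \<Rightarrow> nat \<Rightarrow> 'a::comm_ring_1"
  assumes "\<And>n. A n n = 1"
  obtains x where "\<And>n. (\<Sum>k\<le>n. A n k * x k) = y n"
proof
  show "(\<Sum>k\<le>n. A n k * forward_subst A y k) = y n" for n
    by (subst lessThan_Suc_atMost [symmetric])
      (simp add: assms forward_subst.simps [of A y n])
qed

lemma Phat_app_surj:
  obtains x :: "nat \<Rightarrow> 'a::real_normed_field" where "Phat_app \<tau> x = y"
proof -
  obtain x :: "nat \<Rightarrow> 'a" where "\<And>n. (\<Sum>k\<le>n. of_real (Phat \<tau> n k) * x k) = y n"
    using unitriangular_solve [of "\<lambda>n k. of_real (Phat \<tau> n k)" y] by (auto simp: Phat_diag)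
  then show ?thesis
    by (intro that [of x]) (simp add: Phat_app_def fun_eq_iff)
qed

lemma Phat_app_eq_0_imp:
  assumes "\<And>n. n < j \<Longrightarrow> Phat_app \<tau> x n = 0" and "i < j"
  shows "x i = 0"
  using assms(2)
proof (induction i rule: less_induct)
  case (less i)
  have "Phat_app \<tau> x i = x i"
    using less by (simp add: Phat_app_def Phat_diag lessThan_Suc_atMost [symmetric])
  with assms(1) less.prems show ?case by simp
qed

text \<open>Leading zeros leave only diagonal and subdiagonal entries in rows \<open>j\<close> and
  \<open>Suc j\<close>. This serves both \<open>x\<close> and \<open>abs_seq x\<close>, which vanish
  at the same indices.\<close>

lemma Phat_app_leading:
  assumes "\<And>i. i < j \<Longrightarrow> x i = 0"
  shows "Phat_app \<tau> x j = x j"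
    and "Phat_app \<tau> x (Suc j) = x (Suc j) + of_real (of_nat (Suc j) - \<tau>) * x j"
  using assms
  by (simp_all add: Phat_app_def Phat_diag Phat_subdiag lessThan_Suc_atMost [symmetric])

lemma lp_unit_vector:
  assumes "1 \<le> p"
  shows "(\<lambda>n. if n = j then 1 else 0 :: 'a::real_normed_field) \<in> lp p"
    and "lp_norm p (\<lambda>n. if n = j then 1 else 0 :: 'a) = 1"
proof -
  have "(\<lambda>n. norm (if n = j then 1 else 0 :: 'a) powr p) = (\<lambda>n. if n = j then 1 else 0)"
    using assms by auto
  then show "(\<lambda>n. if n = j then 1 else 0 :: 'a) \<in> lp p"
    and "lp_norm p (\<lambda>n. if n = j then 1 else 0 :: 'a) = 1"
    using sums_single [of j "\<lambda>_. 1 :: real"]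
    by (auto simp: lp_def lp_norm_def sums_iff)
qed

text \<open>Two terms of the series already exceed 1: the one at \<open>i\<close> equals 1 and the
  one at \<open>j\<close> is positive.\<close>

lemma lp_norm_gt_1:
  assumes "0 < p" "z \<in> lp p" "i \<noteq> j" "norm (z i) = 1" "z j \<noteq> 0"
  shows "1 < lp_norm p z"
proof -
  have "1 < (\<Sum>k\<in>{i, j}. norm (z k) powr p)"
    using assms by simp
  also have "\<dots> \<le> (\<Sum>k. norm (z k) powr p)"
    using assms by (intro sum_le_suminf) (auto simp: lp_def)
  finally show ?thesis
    using assms by (simp add: lp_norm_def)
qed

text \<open>The scalars stay generic so that one argument covers the real and the complex
  case.\<close>

lemma non_absolute_type_lp_Phat:
  assumes "1 \<le> p"
  shows "non_absolute_type (lp_Phat p \<tau> :: (nat \<Rightarrow> 'a::real_normed_field) set) (lp_Phat_norm p \<tau>)"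
proof -
  obtain j :: nat where "\<tau> < of_nat j"
    using reals_Archimedean2 by blast
  then have j: "\<tau> < of_nat (Suc j)" by simp
  define e :: "nat \<Rightarrow> 'a" where "e = (\<lambda>n. if n = j then 1 else 0)"
  obtain x :: "nat \<Rightarrow> 'a" where x: "Phat_app \<tau> x = e"
    using Phat_app_surj .
  have x0: "x i = 0" if "i < j" for i
    using Phat_app_eq_0_imp [of j \<tau> x i] that by (simp add: x e_def)
  have xj: "x j = 1"
    using Phat_app_leading(1) [of j x \<tau>] x0 by (simp add: x e_def)
  have "x (Suc j) + of_real (of_nat (Suc j) - \<tau>) = 0"
    using Phat_app_leading(2) [of j x \<tau>] x0 xj by (simp add: x e_def)
  then have "x (Suc j) = - of_real (of_nat (Suc j) - \<tau>)"
    by (simp only: eq_neg_iff_add_eq_0)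
  then have "norm (x (Suc j)) = of_nat (Suc j) - \<tau>"
    using j by (simp only: norm_minus_cancel norm_of_real)
  \<comment> \<open>The two equal summands are the norm of \<open>x (Suc j)\<close> and the
    subdiagonal entry times the norm of \<open>x j\<close>, which is 1.\<close>
  then have "Phat_app \<tau> (abs_seq x) (Suc j) = of_real (2 * (of_nat (Suc j) - \<tau>))"
    using Phat_app_leading(2) [of j "abs_seq x" \<tau>] x0 xj by (simp add: abs_seq_def)
  then have abs_Suc: "Phat_app \<tau> (abs_seq x) (Suc j) \<noteq> 0"
    using j by (simp del: of_real_mult of_real_diff of_nat_Suc)
  have abs_j: "norm (Phat_app \<tau> (abs_seq x) j) = 1"
    using Phat_app_leading(1) [of j "abs_seq x" \<tau>] x0 xj by (simp add: abs_seq_def)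
  have "x \<in> lp_Phat p \<tau>" and norm_x: "lp_Phat_norm p \<tau> x = 1"
    using lp_unit_vector [OF assms, of j] by (simp_all add: lp_Phat_def lp_Phat_norm_def x e_def)
  \<comment> \<open>If \<open>abs_seq x\<close> lies outside the space, its norm counts as infinite
    and so differs from 1 anyway.\<close>
  moreover have "1 < lp_Phat_norm p \<tau> (abs_seq x)" if "abs_seq x \<in> lp_Phat p \<tau>"
    unfolding lp_Phat_norm_def using that assms abs_j abs_Suc
    by (intro lp_norm_gt_1 [of _ _ j "Suc j"]) (auto simp: lp_Phat_def)
  ultimately show ?thesis
    unfolding non_absolute_type_def by (intro bexI [of _ x]) auto
qed

theorem theorem3p4:
  fixes \<tau> p :: real
  assumes "\<tau> \<notin> \<int>\<^sub>\<le>\<^sub>0" and "1 \<le> p"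
  shows "non_absolute_type (lp_Phat p \<tau> :: (nat \<Rightarrow> real) set) (lp_Phat_norm p \<tau>)
       \<and> non_absolute_type (lp_Phat p \<tau> :: (nat \<Rightarrow> complex) set) (lp_Phat_norm p \<tau>)"
  using assms(2) by (intro conjI non_absolute_type_lp_Phat)

end
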